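(* Let $(A,[-,-]_A,\Delta_r)$ be a factorizable Leibniz bialgebra, and let $T_r\oplus T_{\sigma(r)}:A^*\to A\oplus A$ be the linear map $a^*\mapsto(T_r(a^* ),T_{\sigma(r)}(a^* ))$. Then $\mathrm{Im}(T_r\oplus T_{\sigma(r)})$ is a Leibniz subalgebra of the direct sum $A\oplus A$ of Leibniz algebras and is isomorphic (as a Leibniz algebra) to $(A^*,[-,-]_r)$. Moreover, for any $x\in A$ there is a unique decomposition $x=x_1-x_2$ with $(x_1,x_2)\in\mathrm{Im}(T_r\oplus T_{\sigma(r)})$.
   Context: All vector spaces and algebras are finite-dimensional over an algebraically closed field $\mathbb{K}$ of characteristic zero. A (left) Leibniz algebra is a vector space $A$ with a bilinear multiplication $[-,-]_A$ satisfying $[x,[y,z]_A]_A=[[x,y]_A,z]_A+[y,[x,z]_A]_A$. Define $\mathcal{L}_A(x)y=[x,y]_A=\mathcal{R}_A(y)x$, $\sigma(x\otimes y)=y\otimes x$, and $F(x)=(\mathcal{L}_A+\mathcal{R}_A)(x)\otimes\mathrm{id}-\mathrm{id}\otimes\mathcal{R}_A(x)\in\mathrm{End}(A\otimes A)$. For $r=\sum_i a_i\otimes b_i\in A\otimes A$ put $[[r,r]]=\sum_{i,j}\big([a_i,a_j]_A\otimes b_i\otimes b_j-a_i\otimes([b_i,a_j]_A+[a_j,b_i]_A)\otimes b_j+a_i\otimes a_j\otimes[b_j,b_i]_A\big)$; $r$ is a solution of the classical Leibniz Yang-Baxter equation (CLYBE) if $[[r,r]]=0$. Put $\Delta_r(x)=F(x)r$.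 If $r$ is a solution of the CLYBE with $F(x)(r-\sigma(r))=0$ for all $x\in A$, then $(A,[-,-]_A,\Delta_r)$ (which is then a Leibniz bialgebra) is called a quasi-triangular Leibniz bialgebra. For $s\in A\otimes A$ let $T_s:A^*\to A$ be given by $\langle T_s(a^* ),b^*\rangle=\langle s,a^*\otimes b^*\rangle$; so $T_{r-\sigma(r)}=T_r-T_{\sigma(r)}$. A quasi-triangular Leibniz bialgebra $(A,[-,-]_A,\Delta_r)$ is factorizable if $T_{r-\sigma(r)}:A^*\to A$ is a linear isomorphism. The multiplication $[-,-]_r$ on $A^*$ is the linear dual of $\Delta_r$: $\langle\Delta_r(x),a^*\otimes b^*\rangle=\langle x,[a^*,b^*]_r\rangle$; for a quasi-triangular Leibniz bialgebra $(A^*,[-,-]_r)$ is a Leibniz algebra. *)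

theory Defs
  imports
    "HOL-Analysis.Product_Vector"
    "HOL-Library.Function_Algebras"
    "HOL-Computational_Algebra.Polynomial"
begin

text \<open>
  A vector space is given by a type \<open>'a\<close> with its scalar multiplication
  \<open>s\<close>.  Function types carry the pointwise operations of
  \<open>Function_Algebras\<close>; since the dual space is only a subspace of the type \<open>'a \<Rightarrow> 'k\<close>,
  Leibniz algebras are defined on subspaces of a vector space.
\<close>

definition linear_map_on ::
  "'a set \<Rightarrow> ('k \<Rightarrow> 'a \<Rightarrow> 'a) \<Rightarrow> ('k \<Rightarrow> 'b \<Rightarrow> 'b) \<Rightarrow> ('a::ab_group_add \<Rightarrow> 'b::ab_group_add) \<Rightarrow> bool" where
  "linear_map_on S s t \<phi> \<longleftrightarrow>
     (\<forall>x\<in>S. \<forall>y\<in>S. \<phi> (x + y) = \<phi> x + \<phi> y) \<and> (\<forall>c. \<forall>x\<in>S. \<phi> (s c x) = t c (\<phi> x))"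

definition leibniz_algebra_on ::
  "'a set \<Rightarrow> ('k::field \<Rightarrow> 'a \<Rightarrow> 'a) \<Rightarrow> ('a::ab_group_add \<Rightarrow> 'a \<Rightarrow> 'a) \<Rightarrow> bool" where
  "leibniz_algebra_on S s br \<longleftrightarrow>
     vector_space s \<and> module.subspace s S \<and>
     (\<forall>x\<in>S. \<forall>y\<in>S. br x y \<in> S) \<and>
     (\<forall>x\<in>S. linear_map_on S s s (\<lambda>y. br x y) \<and> linear_map_on S s s (\<lambda>y. br y x)) \<and>
     (\<forall>x\<in>S. \<forall>y\<in>S. \<forall>z\<in>S. br x (br y z) = br (br x y) z + br y (br x z))"

abbreviation leibniz_algebra ::
  "('k::field \<Rightarrow> 'a \<Rightarrow> 'a) \<Rightarrow> ('a::ab_group_add \<Rightarrow> 'a \<Rightarrow> 'a) \<Rightarrow> bool" where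
  "leibniz_algebra \<equiv> leibniz_algebra_on UNIV"

definition leibniz_subalgebra ::
  "('k::field \<Rightarrow> 'a \<Rightarrow> 'a) \<Rightarrow> ('a::ab_group_add \<Rightarrow> 'a \<Rightarrow> 'a) \<Rightarrow> 'a set \<Rightarrow> bool" where
  "leibniz_subalgebra s br S \<longleftrightarrow>
     leibniz_algebra s br \<and> module.subspace s S \<and> (\<forall>x\<in>S. \<forall>y\<in>S. br x y \<in> S)"

definition leibniz_isomorphic ::
  "'a set \<Rightarrow> ('k::field \<Rightarrow> 'a \<Rightarrow> 'a) \<Rightarrow> ('a::ab_group_add \<Rightarrow> 'a \<Rightarrow> 'a) \<Rightarrow>
   'b set \<Rightarrow> ('k \<Rightarrow> 'b \<Rightarrow> 'b) \<Rightarrow> ('b::ab_group_add \<Rightarrow> 'b \<Rightarrow> 'b) \<Rightarrow> bool" where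
  "leibniz_isomorphic S s br S' s' br' \<longleftrightarrow>
     leibniz_algebra_on S s br \<and> leibniz_algebra_on S' s' br' \<and>
     (\<exists>\<phi>. bij_betw \<phi> S S' \<and> linear_map_on S s s' \<phi> \<and>
          (\<forall>x\<in>S. \<forall>y\<in>S. \<phi> (br x y) = br' (\<phi> x) (\<phi> y)))"

definition prod_bracket :: "('a \<Rightarrow> 'a \<Rightarrow> 'a) \<Rightarrow> 'a \<times> 'a \<Rightarrow> 'a \<times> 'a \<Rightarrow> 'a \<times> 'a" where
  "prod_bracket br p q = (br (fst p) (fst q), br (snd p) (snd q))"


section \<open>Dual space and tensor products\<close>

definition dual_space :: "('k::field \<Rightarrow> 'a \<Rightarrow> 'a) \<Rightarrow> ('a::ab_group_add \<Rightarrow> 'k) set" where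
  "dual_space s = {f. Vector_Spaces.linear s (*) f}"

definition dual_scale :: "'k::field \<Rightarrow> ('a \<Rightarrow> 'k) \<Rightarrow> 'a \<Rightarrow> 'k" where
  "dual_scale c f = (\<lambda>x. c * f x)"

text \<open>
  For a finite-dimensional space \<open>A\<close>, the tensor powers \<open>A \<otimes> A\<close> and \<open>A \<otimes> A \<otimes> A\<close> are realised as
  multilinear forms on the dual, with \<open>(a \<otimes> b)(f, g) = f a * g b\<close>.  Applying a tensor \<open>t\<close> to
  \<open>f\<close> and \<open>g\<close> is therefore the pairing \<open>\<langle>t, f \<otimes> g\<rangle>\<close>.  Forms take the value 0 on functions that are
  not linear, so that equality of tensors is equality in HOL.  The universal property is
  proved below.
\<close>

definition tensor ::
  "('k::field \<Rightarrow> 'a \<Rightarrow> 'a) \<Rightarrow> 'a::ab_group_add \<Rightarrow> 'a \<Rightarrow> ('a \<Rightarrow> 'k) \<Rightarrow> ('a \<Rightarrow> 'k) \<Rightarrow> 'k" where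
  "tensor s a b = (\<lambda>f g. if f \<in> dual_space s \<and> g \<in> dual_space s then f a * g b else 0)"

definition tensor3 ::
  "('k::field \<Rightarrow> 'a \<Rightarrow> 'a) \<Rightarrow> 'a::ab_group_add \<Rightarrow> 'a \<Rightarrow> 'a \<Rightarrow>
   ('a \<Rightarrow> 'k) \<Rightarrow> ('a \<Rightarrow> 'k) \<Rightarrow> ('a \<Rightarrow> 'k) \<Rightarrow> 'k" where
  "tensor3 s a b c = (\<lambda>f g h.
     if f \<in> dual_space s \<and> g \<in> dual_space s \<and> h \<in> dual_space s
     then f a * g b * h c else 0)"

definition tensor_space ::
  "('k::field \<Rightarrow> 'a \<Rightarrow> 'a) \<Rightarrow> (('a::ab_group_add \<Rightarrow> 'k) \<Rightarrow> ('a \<Rightarrow> 'k) \<Rightarrow> 'k) set" where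
  "tensor_space s = {t. \<exists>(n::nat) a b. t = (\<Sum>i<n. tensor s (a i) (b i))}"

definition flip :: "('f \<Rightarrow> 'f \<Rightarrow> 'k) \<Rightarrow> 'f \<Rightarrow> 'f \<Rightarrow> 'k" where
  "flip t = (\<lambda>f g. t g f)"

text \<open>\<open>tensor_map s \<phi> \<psi>\<close> is the endomorphism \<open>\<phi> \<otimes> \<psi>\<close>.\<close>

definition tensor_map ::
  "('k::field \<Rightarrow> 'a \<Rightarrow> 'a) \<Rightarrow> ('a \<Rightarrow> 'a) \<Rightarrow> ('a \<Rightarrow> 'a) \<Rightarrow>
   (('a::ab_group_add \<Rightarrow> 'k) \<Rightarrow> ('a \<Rightarrow> 'k) \<Rightarrow> 'k) \<Rightarrow> ('a \<Rightarrow> 'k) \<Rightarrow> ('a \<Rightarrow> 'k) \<Rightarrow> 'k" where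
  "tensor_map s \<phi> \<psi> t = (\<lambda>f g.
     if f \<in> dual_space s \<and> g \<in> dual_space s then t (f \<circ> \<phi>) (g \<circ> \<psi>) else 0)"

text \<open>\<open>tensor_to_map s t\<close> is \<open>T\<^sub>t\<close>, determined by \<open>\<langle>T\<^sub>t f, g\<rangle> = \<langle>t, f \<otimes> g\<rangle>\<close>.\<close>

definition tensor_to_map ::
  "('k::field \<Rightarrow> 'a \<Rightarrow> 'a) \<Rightarrow> (('a::ab_group_add \<Rightarrow> 'k) \<Rightarrow> ('a \<Rightarrow> 'k) \<Rightarrow> 'k) \<Rightarrow> ('a \<Rightarrow> 'k) \<Rightarrow> 'a" where
  "tensor_to_map s t f = (THE x. \<forall>g\<in>dual_space s. g x = t f g)"


section \<open>Factorizable Leibniz bialgebras\<close>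

definition leibniz_F ::
  "('k::field \<Rightarrow> 'a \<Rightarrow> 'a) \<Rightarrow> ('a \<Rightarrow> 'a \<Rightarrow> 'a) \<Rightarrow> 'a \<Rightarrow>
   (('a::ab_group_add \<Rightarrow> 'k) \<Rightarrow> ('a \<Rightarrow> 'k) \<Rightarrow> 'k) \<Rightarrow> ('a \<Rightarrow> 'k) \<Rightarrow> ('a \<Rightarrow> 'k) \<Rightarrow> 'k" where
  "leibniz_F s br x t =
     tensor_map s (\<lambda>y. br x y + br y x) id t - tensor_map s id (\<lambda>y. br y x) t"

definition bracket_sum ::
  "('k::field \<Rightarrow> 'a \<Rightarrow> 'a) \<Rightarrow> ('a \<Rightarrow> 'a \<Rightarrow> 'a) \<Rightarrow> nat \<Rightarrow> (nat \<Rightarrow> 'a::ab_group_add) \<Rightarrow> (nat \<Rightarrow> 'a) \<Rightarrow>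
   ('a \<Rightarrow> 'k) \<Rightarrow> ('a \<Rightarrow> 'k) \<Rightarrow> ('a \<Rightarrow> 'k) \<Rightarrow> 'k" where
  "bracket_sum s br n a b = (\<Sum>i<n. \<Sum>j<n.
     tensor3 s (br (a i) (a j)) (b i) (b j)
     - tensor3 s (a i) (br (b i) (a j) + br (a j) (b i)) (b j)
     + tensor3 s (a i) (a j) (br (b j) (b i)))"

text \<open>
  \<open>double_bracket s br r\<close> is \<open>[[r, r]]\<close>.  The value does not depend on the chosen expression of
  \<open>r\<close> as a sum of pure tensors, see \<open>double_bracket_eq\<close> below.
\<close>

definition double_bracket ::
  "('k::field \<Rightarrow> 'a \<Rightarrow> 'a) \<Rightarrow> ('a \<Rightarrow> 'a \<Rightarrow> 'a) \<Rightarrow> (('a::ab_group_add \<Rightarrow> 'k) \<Rightarrow> ('a \<Rightarrow> 'k) \<Rightarrow> 'k) \<Rightarrow>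
   ('a \<Rightarrow> 'k) \<Rightarrow> ('a \<Rightarrow> 'k) \<Rightarrow> ('a \<Rightarrow> 'k) \<Rightarrow> 'k" where
  "double_bracket s br r =
     (THE w. \<exists>n a b. r = (\<Sum>i<n. tensor s (a i) (b i)) \<and> w = bracket_sum s br n a b)"

definition clybe_solution ::
  "('k::field \<Rightarrow> 'a \<Rightarrow> 'a) \<Rightarrow> ('a \<Rightarrow> 'a \<Rightarrow> 'a) \<Rightarrow> (('a::ab_group_add \<Rightarrow> 'k) \<Rightarrow> ('a \<Rightarrow> 'k) \<Rightarrow> 'k) \<Rightarrow> bool"
  where
  "clybe_solution s br r \<longleftrightarrow> r \<in> tensor_space s \<and> double_bracket s br r = 0"

definition coproduct ::
  "('k::field \<Rightarrow> 'a \<Rightarrow> 'a) \<Rightarrow> ('a \<Rightarrow> 'a \<Rightarrow> 'a) \<Rightarrow> (('a::ab_group_add \<Rightarrow> 'k) \<Rightarrow> ('a \<Rightarrow> 'k) \<Rightarrow> 'k) \<Rightarrow>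
   'a \<Rightarrow> ('a \<Rightarrow> 'k) \<Rightarrow> ('a \<Rightarrow> 'k) \<Rightarrow> 'k" where
  "coproduct s br r x = leibniz_F s br x r"

definition dual_bracket ::
  "('k::field \<Rightarrow> 'a \<Rightarrow> 'a) \<Rightarrow> ('a \<Rightarrow> 'a \<Rightarrow> 'a) \<Rightarrow> (('a::ab_group_add \<Rightarrow> 'k) \<Rightarrow> ('a \<Rightarrow> 'k) \<Rightarrow> 'k) \<Rightarrow>
   ('a \<Rightarrow> 'k) \<Rightarrow> ('a \<Rightarrow> 'k) \<Rightarrow> 'a \<Rightarrow> 'k" where
  "dual_bracket s br r f g = (\<lambda>x. coproduct s br r x f g)"

definition quasi_triangular ::
  "('k::field \<Rightarrow> 'a \<Rightarrow> 'a) \<Rightarrow> ('a \<Rightarrow> 'a \<Rightarrow> 'a) \<Rightarrow> (('a::ab_group_add \<Rightarrow> 'k) \<Rightarrow> ('a \<Rightarrow> 'k) \<Rightarrow> 'k) \<Rightarrow> bool"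
  where
  "quasi_triangular s br r \<longleftrightarrow>
     leibniz_algebra s br \<and> clybe_solution s br r \<and>
     (\<forall>x. leibniz_F s br x (r - flip r) = 0)"

definition factorizable ::
  "('k::field \<Rightarrow> 'a \<Rightarrow> 'a) \<Rightarrow> ('a \<Rightarrow> 'a \<Rightarrow> 'a) \<Rightarrow> (('a::ab_group_add \<Rightarrow> 'k) \<Rightarrow> ('a \<Rightarrow> 'k) \<Rightarrow> 'k) \<Rightarrow> bool"
  where
  "factorizable s br r \<longleftrightarrow>
     quasi_triangular s br r \<and>
     linear_map_on (dual_space s) dual_scale s (tensor_to_map s (r - flip r)) \<and>
     bij_betw (tensor_to_map s (r - flip r)) (dual_space s) UNIV"

text \<open>The image of \<open>T\<^sub>r \<oplus> T\<^bsub>\<sigma>(r)\<^esub>\<close> in \<open>A \<oplus> A\<close>.\<close>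

definition image_T_sum ::
  "('k::field \<Rightarrow> 'a \<Rightarrow> 'a) \<Rightarrow> (('a::ab_group_add \<Rightarrow> 'k) \<Rightarrow> ('a \<Rightarrow> 'k) \<Rightarrow> 'k) \<Rightarrow> ('a \<times> 'a) set" where
  "image_T_sum s r =
     (\<lambda>f. (tensor_to_map s r f, tensor_to_map s (flip r) f)) ` dual_space s"


section \<open>The definitions on pure tensors\<close>

lemma sum_fun2_apply: "(\<Sum>i\<in>I. F i) f g = (\<Sum>i\<in>I. F i f g)"
  for F :: "'i \<Rightarrow> 'f \<Rightarrow> 'g \<Rightarrow> 'k::comm_monoid_add"
  by (induction I rule: infinite_finite_induct) (auto simp: zero_fun_def)

lemma sum_fun3_apply: "(\<Sum>i\<in>I. F i) f g h = (\<Sum>i\<in>I. F i f g h)"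
  for F :: "'i \<Rightarrow> 'f \<Rightarrow> 'g \<Rightarrow> 'h \<Rightarrow> 'k::comm_monoid_add"
  by (induction I rule: infinite_finite_induct) (auto simp: zero_fun_def)

context vector_space
begin

lemma dual_spaceI:
  assumes "\<And>x y. f (x + y) = f x + f y" "\<And>c x. f (scale c x) = c * f x"
  shows "f \<in> dual_space scale"
  unfolding dual_space_def mem_Collect_eq Vector_Spaces.linear_def
proof (intro conjI)
  show "vector_space scale" by (rule vector_space_axioms)
  show "vector_space ((*) :: 'a \<Rightarrow> 'a \<Rightarrow> 'a)"
    by unfold_locales (simp_all add: algebra_simps)
  then show "module_hom scale ((*) :: 'a \<Rightarrow> 'a \<Rightarrow> 'a) f"
    unfolding module_hom_def module_hom_axioms_def
    using assms module_axioms by (simp add: vector_space_def module_def)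
qed

lemma dual_space_add: "f \<in> dual_space scale \<Longrightarrow> f (x + y) = f x + f y"
  by (auto simp: dual_space_def Vector_Spaces.linear_def dest: module_hom.add)

lemma dual_space_scale: "f \<in> dual_space scale \<Longrightarrow> f (scale c x) = c * f x"
  by (auto simp: dual_space_def Vector_Spaces.linear_def dest: module_hom.scale)

lemma flip_tensor: "flip (tensor scale a b) = tensor scale b a"
  by (auto simp: flip_def tensor_def fun_eq_iff)

lemma tensor_map_tensor:
  assumes "Vector_Spaces.linear scale scale \<phi>" "Vector_Spaces.linear scale scale \<psi>"
  shows "tensor_map scale \<phi> \<psi> (tensor scale a b) = tensor scale (\<phi> a) (\<psi> b)"
proof -
  have "f \<circ> \<phi> \<in> dual_space scale" "f \<circ> \<psi> \<in> dual_space scale" if "f \<in> dual_space scale" for f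
    using that assms by (auto simp: dual_space_def intro: Vector_Spaces.linear_compose)
  then show ?thesis by (auto simp: tensor_map_def tensor_def fun_eq_iff)
qed

lemma bracket_sum_apply:
  assumes br: "leibniz_algebra scale br"
    and r: "r = (\<Sum>i<n. tensor scale (a i) (b i))"
    and [simp]: "f \<in> dual_space scale" "g \<in> dual_space scale" "h \<in> dual_space scale"
  shows "bracket_sum scale br n a b f g h =
    r (\<lambda>y. r (\<lambda>x. f (br x y)) g) h - r f (\<lambda>x. r (\<lambda>y. g (br x y + br y x)) h)
    + r f (\<lambda>x. r g (\<lambda>y. h (br y x)))"
proof -
  have R: "r u v = (\<Sum>i<n. u (a i) * v (b i))"
    if "u \<in> dual_space scale" "v \<in> dual_space scale" for u v
    using that by (simp add: r sum_fun2_apply tensor_def)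
  have br_lin: "br x (y + z) = br x y + br x z" "br (y + z) x = br y x + br z x"
    "br x (scale c y) = scale c (br x y)" "br (scale c y) x = scale c (br y x)" for x y z c
    using br by (auto simp: leibniz_algebra_on_def linear_map_on_def)
  note lin = br_lin dual_space_add dual_space_scale
  have d: "(\<lambda>x. u (br x y)) \<in> dual_space scale"
    "(\<lambda>x. u (br y x)) \<in> dual_space scale"
    "(\<lambda>x. u (br y x + br x y)) \<in> dual_space scale"
    if "u \<in> dual_space scale" for u y
    using that by (auto intro!: dual_spaceI simp: lin algebra_simps)
  have sum_dual: "(\<lambda>x. \<Sum>i<n. U i x * c i) \<in> dual_space scale"
    "(\<lambda>x. \<Sum>i<n. c i * U i x) \<in> dual_space scale"
    if "\<And>i. U i \<in> dual_space scale" for U and c :: "nat \<Rightarrow> 'a"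
    using that by (auto intro!: dual_spaceI simp: lin algebra_simps sum.distrib sum_distrib_left)
  have 1: "r (\<lambda>y. r (\<lambda>x. f (br x y)) g) h =
      (\<Sum>i<n. \<Sum>j<n. f (br (a i) (a j)) * g (b i) * h (b j))"
    by (subst sum.swap) (simp add: R d sum_dual sum_distrib_right)
  have 2: "r f (\<lambda>x. r (\<lambda>y. g (br x y + br y x)) h) =
      (\<Sum>i<n. \<Sum>j<n. f (a i) * g (br (b i) (a j) + br (a j) (b i)) * h (b j))"
  proof -
    have "(\<lambda>x. g (br x y + br y x)) \<in> dual_space scale" for y
      by (auto intro!: dual_spaceI simp: lin algebra_simps)
    then show ?thesis by (simp add: R d sum_dual sum_distrib_left mult.assoc)
  qed
  have 3: "r f (\<lambda>x. r g (\<lambda>y. h (br y x))) =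
      (\<Sum>i<n. \<Sum>j<n. f (a i) * g (a j) * h (br (b j) (b i)))"
    by (simp add: R d sum_dual sum_distrib_left mult.assoc)
  show ?thesis
    unfolding 1 2 3
    by (simp add: bracket_sum_def sum_fun3_apply tensor3_def sum.distrib sum_subtractf)
qed

lemma bracket_sum_outside:
  assumes "\<not> (f \<in> dual_space scale \<and> g \<in> dual_space scale \<and> h \<in> dual_space scale)"
  shows "bracket_sum scale br n a b f g h = 0"
  using assms by (auto simp: bracket_sum_def sum_fun3_apply tensor3_def)

lemma double_bracket_eq:
  assumes "leibniz_algebra scale br" and "r = (\<Sum>i<n. tensor scale (a i) (b i))"
  shows "double_bracket scale br r = bracket_sum scale br n a b"
  unfolding double_bracket_def
proof (rule the_equality)
  show "\<exists>n' a' b'. r = (\<Sum>i<n'. tensor scale (a' i) (b' i)) \<and>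
          bracket_sum scale br n a b = bracket_sum scale br n' a' b'"
    using assms(2) by blast
  fix w assume "\<exists>n' a' b'. r = (\<Sum>i<n'. tensor scale (a' i) (b' i)) \<and>
          w = bracket_sum scale br n' a' b'"
  then obtain n' a' b' where r: "r = (\<Sum>i<n'. tensor scale (a' i) (b' i))"
    and w: "w = bracket_sum scale br n' a' b'" by blast
  have "bracket_sum scale br n' a' b' f g h = bracket_sum scale br n a b f g h" for f g h
  proof (cases "f \<in> dual_space scale \<and> g \<in> dual_space scale \<and> h \<in> dual_space scale")
    case True
    then show ?thesis
      using bracket_sum_apply[OF assms(1) r, of f g h] bracket_sum_apply[OF assms, of f g h]
      by simp
  qed (simp add: bracket_sum_outside)
  then show "w = bracket_sum scale br n a b" by (simp add: w fun_eq_iff)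
qed

end

context finite_dimensional_vector_space
begin

lemma coordinate_in_dual: "(\<lambda>v. representation Basis v e) \<in> dual_space scale"
  unfolding dual_space_def
  using linear_representation[OF independent_Basis span_Basis] by simp

lemma dual_separates:
  assumes "\<And>f. f \<in> dual_space scale \<Longrightarrow> f x = f y"
  shows "x = y"
proof -
  have "representation Basis x = representation Basis y"
    using assms[OF coordinate_in_dual] by (simp add: fun_eq_iff)
  moreover have "v = (\<Sum>e\<in>Basis. scale (representation Basis v e) e)" for v
    using sum_representation_eq[OF independent_Basis _ finite_Basis subset_refl, of v]
    by (simp add: span_Basis)
  ultimately show ?thesis by metis
qed

lemma tensor_to_map_sum:
  fixes n :: nat
  assumes "f \<in> dual_space scale"
  shows "tensor_to_map scale (\<Sum>i<n. tensor scale (a i) (b i)) f = (\<Sum>i<n. scale (f (a i)) (b i))"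
  unfolding tensor_to_map_def
proof (rule the_equality)
  have g: "g (\<Sum>i<n. scale (f (a i)) (b i)) = (\<Sum>i<n. tensor scale (a i) (b i)) f g"
    if "g \<in> dual_space scale" for g
  proof -
    have g0: "g 0 = 0" using dual_space_scale[OF that, of 0 0] by simp
    have "g (\<Sum>i<n. scale (f (a i)) (b i)) = (\<Sum>i<n. f (a i) * g (b i))"
      by (induction n) (simp_all add: g0 dual_space_add[OF that] dual_space_scale[OF that])
    then show ?thesis using that assms by (simp add: sum_fun2_apply tensor_def)
  qed
  then show "\<forall>g\<in>dual_space scale. g (\<Sum>i<n. scale (f (a i)) (b i)) =
      (\<Sum>i<n. tensor scale (a i) (b i)) f g" by blast
  fix x assume "\<forall>g\<in>dual_space scale. g x = (\<Sum>i<n. tensor scale (a i) (b i)) f g"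
  then show "x = (\<Sum>i<n. scale (f (a i)) (b i))"
    by (intro dual_separates) (simp add: g)
qed

text \<open>
  The universal property: every bilinear or trilinear map \<open>B\<close> factors through the tensor
  product.  Only existence is stated, as pure tensors span by definition.
\<close>

lemma tensor_universal:
  fixes s :: "'a \<Rightarrow> 'c::ab_group_add \<Rightarrow> 'c"
  assumes "vector_space s"
    and "\<And>x. Vector_Spaces.linear scale s (\<lambda>y. B x y)"
    and "\<And>y. Vector_Spaces.linear scale s (\<lambda>x. B x y)"
  shows "\<exists>L. (\<forall>t u. L (t + u) = L t + L u) \<and>
             (\<forall>c t. L (\<lambda>f g. c * t f g) = s c (L t)) \<and>
             (\<forall>x y. L (tensor scale x y) = B x y)"
proof -
  interpret s: vector_space s by fact
  define R where "R e = (\<lambda>v. representation Basis v e)" for e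
  have R: "R e \<in> dual_space scale" for e unfolding R_def by (rule coordinate_in_dual)
  have ex: "v = (\<Sum>e\<in>Basis. scale (R e v) e)" for v
    using sum_representation_eq[OF independent_Basis _ finite_Basis subset_refl, of v]
    by (simp add: span_Basis R_def)
  have hom: "H v = (\<Sum>e\<in>Basis. s (R e v) (H e))"
    if "Vector_Spaces.linear scale s H" for H v
  proof -
    interpret H: Vector_Spaces.linear scale s H by fact
    show ?thesis by (subst ex[of v]) (simp add: H.sum H.scale)
  qed
  define L where "L t = (\<Sum>e\<in>Basis. \<Sum>e'\<in>Basis. s (t (R e) (R e')) (B e e'))" for t
  have "L (tensor scale x y) = B x y" for x y
  proof -
    have "B x y = (\<Sum>e\<in>Basis. s (R e x) (\<Sum>e'\<in>Basis. s (R e' y) (B e e')))"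
      by (subst hom[OF assms(3)[of y], of x], subst hom[OF assms(2), of _ y]) (rule refl)
    then show ?thesis by (simp add: L_def tensor_def R s.scale_sum_right)
  qed
  moreover have "L (t + u) = L t + L u" "L (\<lambda>f g. c * t f g) = s c (L t)" for t u c
    by (simp_all add: L_def s.scale_left_distrib sum.distrib s.scale_sum_right)
  ultimately show ?thesis by blast
qed

lemma tensor3_universal:
  fixes s :: "'a \<Rightarrow> 'c::ab_group_add \<Rightarrow> 'c"
  assumes "vector_space s"
    and "\<And>x y. Vector_Spaces.linear scale s (\<lambda>z. B x y z)"
    and "\<And>x z. Vector_Spaces.linear scale s (\<lambda>y. B x y z)"
    and "\<And>y z. Vector_Spaces.linear scale s (\<lambda>x. B x y z)"
  shows "\<exists>L. (\<forall>t u. L (t + u) = L t + L u) \<and>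
             (\<forall>c t. L (\<lambda>f g h. c * t f g h) = s c (L t)) \<and>
             (\<forall>x y z. L (tensor3 scale x y z) = B x y z)"
proof -
  interpret s: vector_space s by fact
  define R where "R e = (\<lambda>v. representation Basis v e)" for e
  have R: "R e \<in> dual_space scale" for e unfolding R_def by (rule coordinate_in_dual)
  have ex: "v = (\<Sum>e\<in>Basis. scale (R e v) e)" for v
    using sum_representation_eq[OF independent_Basis _ finite_Basis subset_refl, of v]
    by (simp add: span_Basis R_def)
  have hom: "H v = (\<Sum>e\<in>Basis. s (R e v) (H e))"
    if "Vector_Spaces.linear scale s H" for H v
  proof -
    interpret H: Vector_Spaces.linear scale s H by fact
    show ?thesis by (subst ex[of v]) (simp add: H.sum H.scale)
  qed
  define L where "L t =
    (\<Sum>e\<in>Basis. \<Sum>e'\<in>Basis. \<Sum>e''\<in>Basis. s (t (R e) (R e') (R e'')) (B e e' e''))" for t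
  have "L (tensor3 scale x y z) = B x y z" for x y z
  proof -
    have "B x y z = (\<Sum>e\<in>Basis. s (R e x) (\<Sum>e'\<in>Basis. s (R e' y)
        (\<Sum>e''\<in>Basis. s (R e'' z) (B e e' e''))))"
      by (subst hom[OF assms(4)[of y z], of x], subst hom[OF assms(3)[of _ z], of _ y],
          subst hom[OF assms(2), of _ _ z]) (rule refl)
    then show ?thesis by (simp add: L_def tensor3_def R s.scale_sum_right mult.assoc)
  qed
  moreover have "L (t + u) = L t + L u" "L (\<lambda>f g h. c * t f g h) = s c (L t)" for t u c
    by (simp_all add: L_def s.scale_left_distrib sum.distrib s.scale_sum_right)
  ultimately show ?thesis by blast
qed

end

end

theory Submission
  imports Defs
begin

text \<open>
  Write \<open>P = T\<^sub>r\<close> and \<open>Q = T\<^bsub>\<sigma>(r)\<^esub>\<close>; these maps are adjoint, \<open>g (P f) = f (Q g)\<close>.  Paired with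
  \<open>f \<otimes> g \<otimes> h\<close>, the Yang-Baxter equation reads
  \<open>f [Q g, Q h] - g ([P f, Q h] + [Q h, P f]) + h [P g, P f] = 0\<close>, and the dual bracket is
  \<open>[f, g]\<^sub>r x = f ([x, Q g] + [Q g, x]) - g [P f, x]\<close>.  Permuting the arguments, the equation
  says that \<open>Q\<close> is a homomorphism; together with the invariance of \<open>r - \<sigma>(r)\<close> at \<open>x = Q h\<close>
  it says the same of \<open>P\<close>.  As \<open>P - Q\<close> is bijective, \<open>P \<oplus> Q\<close> is an injective homomorphism into
  \<open>A \<oplus> A\<close>, which transports the Leibniz identity back to the dual, and every \<open>x\<close> is
  \<open>P f - Q f\<close> for exactly one \<open>f\<close>.
\<close>

section \<open>Transport of Leibniz structures along injective linear maps\<close>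

lemma linear_map_on_inv_into:
  assumes s: "vector_space s" and S: "module.subspace s S"
    and lin: "linear_map_on S s t \<phi>" and inj: "inj_on \<phi> S"
  shows "linear_map_on (\<phi> ` S) t s (inv_into S \<phi>)"
proof -
  interpret vector_space s by fact
  have "inv_into S \<phi> (\<phi> x + \<phi> y) = x + y" if "x \<in> S" "y \<in> S" for x y
    using lin that inv_into_f_f[OF inj subspace_add[OF S that]]
    by (simp add: linear_map_on_def)
  moreover have "inv_into S \<phi> (t c (\<phi> x)) = s c x" if "x \<in> S" for c x
    using lin that inv_into_f_f[OF inj subspace_scale[OF S that]]
    by (simp add: linear_map_on_def)
  ultimately show ?thesis
    using inj by (auto simp: linear_map_on_def)
qed

lemma leibniz_algebra_on_subspace:
  assumes "leibniz_algebra s br" "module.subspace s S" "\<And>x y. x \<in> S \<Longrightarrow> y \<in> S \<Longrightarrow> br x y \<in> S"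
  shows "leibniz_algebra_on S s br"
  using assms unfolding leibniz_algebra_on_def linear_map_on_def by blast

lemma subspace_linear_map_on_image:
  assumes s: "vector_space s" and t: "vector_space t" and S: "module.subspace s S"
    and lin: "linear_map_on S s t \<phi>"
  shows "module.subspace t (\<phi> ` S)"
proof -
  interpret s: vector_space s by fact
  interpret t: vector_space t by fact
  have add: "\<phi> (x + y) = \<phi> x + \<phi> y" "\<phi> (s c x) = t c (\<phi> x)" if "x \<in> S" "y \<in> S" for x y c
    using lin that by (auto simp: linear_map_on_def)
  have "\<phi> 0 = 0"
    using add(2)[of 0 0 0] s.subspace_0[OF S] by simp
  then have "0 \<in> \<phi> ` S"
    using s.subspace_0[OF S] by force
  moreover have "\<phi> x + \<phi> y \<in> \<phi> ` S" "t c (\<phi> x) \<in> \<phi> ` S" if "x \<in> S" "y \<in> S" for x y c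
    using s.subspace_add[OF S that] s.subspace_scale[OF S that(1)] add[OF that, symmetric]
    by simp_all
  ultimately show ?thesis
    by (intro t.subspaceI) auto
qed

text \<open>An equation between elements of \<open>S\<close> can be checked after applying the
  injective map \<phi>, where it becomes an instance of the same law for \<open>br'\<close>. For the
  dual bracket this yields the Leibniz identity without a direct computation with the
  coproduct.\<close>

lemma leibniz_algebra_on_pullback:
  assumes s: "vector_space s" and S: "module.subspace s S"
    and closed: "\<And>x y. x \<in> S \<Longrightarrow> y \<in> S \<Longrightarrow> br x y \<in> S"
    and A: "leibniz_algebra t br'"
    and lin: "linear_map_on S s t \<phi>" and inj: "inj_on \<phi> S"
    and hom: "\<And>x y. x \<in> S \<Longrightarrow> y \<in> S \<Longrightarrow> \<phi> (br x y) = br' (\<phi> x) (\<phi> y)"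
  shows "leibniz_algebra_on S s br"
proof -
  interpret vector_space s by fact
  have \<phi>: "\<phi> (x + y) = \<phi> x + \<phi> y" "\<phi> (s c x) = t c (\<phi> x)" if "x \<in> S" "y \<in> S" for x y c
    using lin that by (auto simp: linear_map_on_def)
  have br': "br' x (y + z) = br' x y + br' x z" "br' (y + z) x = br' y x + br' z x"
    "br' x (t c y) = t c (br' x y)" "br' (t c y) x = t c (br' y x)"
    "br' x (br' y z) = br' (br' x y) z + br' y (br' x z)" for x y z c
    using A unfolding leibniz_algebra_on_def linear_map_on_def by blast+
  have eqI: "x = y" if "\<phi> x = \<phi> y" "x \<in> S" "y \<in> S" for x y
    using inj that by (auto dest: inj_onD)
  note S_mem = subspace_add[OF S] subspace_scale[OF S] closed
  show ?thesis
    unfolding leibniz_algebra_on_def linear_map_on_def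
  proof (intro conjI ballI allI s S closed)
    fix x y z c assume xyz: "x \<in> S" "y \<in> S" "z \<in> S"
    show "br x (br y z) = br (br x y) z + br y (br x z)"
      using xyz by (intro eqI) (simp_all add: S_mem \<phi> hom br'(5)[of "\<phi> x" "\<phi> y" "\<phi> z"])
    show "br x (y + z) = br x y + br x z" "br (y + z) x = br y x + br z x"
      using xyz by (intro eqI; simp add: S_mem \<phi> hom br')+
  next
    fix x y c assume xy: "x \<in> S" "y \<in> S"
    show "br x (s c y) = s c (br x y)" "br (s c y) x = s c (br y x)"
      using xy by (intro eqI; simp add: S_mem \<phi>[OF _ xy(1)] hom br')+
  qed
qed

text \<open>The isomorphism sought starts at the image, so its witness is
  \<open>inv_into S \<phi>\<close>, which inherits linearity and multiplicativity from
  \<phi>.\<close>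

lemma leibniz_isomorphic_image:
  assumes s: "vector_space s" and S: "module.subspace s S"
    and closed: "\<And>x y. x \<in> S \<Longrightarrow> y \<in> S \<Longrightarrow> br x y \<in> S"
    and A: "leibniz_algebra t br'"
    and lin: "linear_map_on S s t \<phi>" and inj: "inj_on \<phi> S"
    and hom: "\<And>x y. x \<in> S \<Longrightarrow> y \<in> S \<Longrightarrow> \<phi> (br x y) = br' (\<phi> x) (\<phi> y)"
  shows "leibniz_subalgebra t br' (\<phi> ` S)"
    and "leibniz_isomorphic (\<phi> ` S) t br' S s br"
proof -
  have t: "vector_space t"
    using A by (simp add: leibniz_algebra_on_def)
  have sub: "module.subspace t (\<phi> ` S)"
    by (rule subspace_linear_map_on_image[OF s t S lin])
  have image_closed: "br' x y \<in> \<phi> ` S" if "x \<in> \<phi> ` S" "y \<in> \<phi> ` S" for x y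
    using that closed by (auto simp flip: hom)
  show "leibniz_subalgebra t br' (\<phi> ` S)"
    using A sub image_closed by (auto simp: leibniz_subalgebra_def)
  have "inv_into S \<phi> (br' x y) = br (inv_into S \<phi> x) (inv_into S \<phi> y)"
    if "x \<in> \<phi> ` S" "y \<in> \<phi> ` S" for x y
    using that inj closed by (auto simp flip: hom)
  then show "leibniz_isomorphic (\<phi> ` S) t br' S s br"
    unfolding leibniz_isomorphic_def
  proof (intro conjI exI[of _ "inv_into S \<phi>"] ballI)
    show "leibniz_algebra_on (\<phi> ` S) t br'"
      by (rule leibniz_algebra_on_subspace[OF A sub image_closed])
    show "leibniz_algebra_on S s br"
      using leibniz_algebra_on_pullback[OF s S _ A lin inj] closed hom by simp
    show "bij_betw (inv_into S \<phi>) (\<phi> ` S) S"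
      using inj by (intro bij_betw_inv_into inj_on_imp_bij_betw)
    show "linear_map_on (\<phi> ` S) t s (inv_into S \<phi>)"
      by (rule linear_map_on_inv_into[OF s S lin inj])
  qed
qed

lemma leibniz_algebra_prod:
  assumes "leibniz_algebra s br"
  shows "leibniz_algebra (module_prod.scale s s) (prod_bracket br)"
proof -
  interpret vector_space s
    using assms by (simp add: leibniz_algebra_on_def)
  interpret p: vector_space_prod s s ..
  have br: "br x (y + z) = br x y + br x z" "br (y + z) x = br y x + br z x"
    "br x (s c y) = s c (br x y)" "br (s c y) x = s c (br y x)"
    and jacobi: "br x (br y z) = br (br x y) z + br y (br x z)" for x y z c
    using assms unfolding leibniz_algebra_on_def linear_map_on_def by blast+
  show ?thesis
    unfolding leibniz_algebra_on_def linear_map_on_def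
  proof (intro conjI ballI allI)
    fix x y z
    show "prod_bracket br x (prod_bracket br y z) =
        prod_bracket br (prod_bracket br x y) z + prod_bracket br y (prod_bracket br x z)"
      using jacobi[of "fst x" "fst y" "fst z"] jacobi[of "snd x" "snd y" "snd z"]
      by (simp add: prod_bracket_def)
  qed (simp_all add: prod_bracket_def p.scale_def br p.p.vector_space_axioms)
qed

section \<open>The dual space and the linear map attached to a tensor\<close>

context vector_space
begin

lemma vector_space_dual_scale: "vector_space (dual_scale :: 'a \<Rightarrow> ('b \<Rightarrow> 'a) \<Rightarrow> _)"
  by unfold_locales (auto simp: dual_scale_def fun_eq_iff algebra_simps)

lemma subspace_dual_space: "module.subspace dual_scale (dual_space scale)"
proof -
  interpret d: vector_space "dual_scale :: 'a \<Rightarrow> ('b \<Rightarrow> 'a) \<Rightarrow> _"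
    by (rule vector_space_dual_scale)
  show ?thesis
    by (intro d.subspaceI dual_spaceI)
      (auto simp: dual_scale_def dual_space_add dual_space_scale algebra_simps)
qed

lemma dual_space_diff: "f \<in> dual_space scale \<Longrightarrow> f (x - y) = f x - f y"
  using dual_space_add[of f "x - y" y] by simp

lemma flip_sum: "flip (\<Sum>i<n. tensor scale (a i) (b i)) = (\<Sum>i<n. tensor scale (b i) (a i))"
  for n :: nat
  by (auto simp: flip_def sum_fun2_apply tensor_def fun_eq_iff mult.commute intro!: sum.cong)

end

context finite_dimensional_vector_space
begin

text \<open>Linear functionals separate points, so the pairing fixes the value. This form also
  serves for \<open>r - flip r\<close> without writing it as a sum of pure tensors.\<close>

lemma tensor_to_map_eqI:
  assumes "\<And>g. g \<in> dual_space scale \<Longrightarrow> g x = t f g"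
  shows "tensor_to_map scale t f = x"
  unfolding tensor_to_map_def using assms
  by (auto intro: dual_separates)

text \<open>For a sum of pure tensors the definite description has an explicit value, by
  \<open>tensor_to_map_sum\<close>; the defining pairing can be read off from it.\<close>

lemma apply_tensor_to_map:
  assumes "t \<in> tensor_space scale" "f \<in> dual_space scale" "g \<in> dual_space scale"
  shows "g (tensor_to_map scale t f) = t f g"
proof -
  obtain n :: nat and a b where t: "t = (\<Sum>i<n. tensor scale (a i) (b i))"
    using assms(1) by (auto simp: tensor_space_def)
  have "g 0 = 0" using dual_space_scale[OF assms(3), of 0 0] by simp
  then have "g (\<Sum>i<n. scale (f (a i)) (b i)) = (\<Sum>i<n. f (a i) * g (b i))"
    by (induction n) (simp_all add: dual_space_add[OF assms(3)] dual_space_scale[OF assms(3)])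
  then show ?thesis
    unfolding t tensor_to_map_sum[OF assms(2)] using assms(2,3)
    by (simp add: sum_fun2_apply tensor_def)
qed

lemma flip_tensor_space: "t \<in> tensor_space scale \<Longrightarrow> flip t \<in> tensor_space scale"
  by (force simp: tensor_space_def flip_sum)

text \<open>Both sides are equal to \<open>t g f\<close>.\<close>

lemma apply_tensor_to_map_flip:
  assumes "t \<in> tensor_space scale" "f \<in> dual_space scale" "g \<in> dual_space scale"
  shows "g (tensor_to_map scale (flip t) f) = f (tensor_to_map scale t g)"
  using assms by (simp add: apply_tensor_to_map flip_tensor_space) (simp add: flip_def)

lemma linear_map_on_tensor_to_map:
  assumes t: "t \<in> tensor_space scale"
  shows "linear_map_on (dual_space scale) dual_scale scale (tensor_to_map scale t)"
proof -
  interpret d: vector_space "dual_scale :: 'a \<Rightarrow> ('b \<Rightarrow> 'a) \<Rightarrow> _"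
    by (rule vector_space_dual_scale)
  \<comment> \<open>Adjointness moves \<open>f\<close> from the argument of the map to the place of
    the functional; linearity in \<open>f\<close> is then the pointwise definition of the operations
    on the dual.\<close>
  note adj = apply_tensor_to_map_flip[OF t, symmetric]
  show ?thesis
    unfolding linear_map_on_def
    by (intro conjI ballI allI; rule dual_separates)
      (simp_all add: adj dual_space_add dual_space_scale d.subspace_add d.subspace_scale
        subspace_dual_space, simp_all add: dual_scale_def)
qed

lemma tensor_to_map_minus_flip:
  assumes "r \<in> tensor_space scale" "f \<in> dual_space scale"
  shows "tensor_to_map scale (r - flip r) f = tensor_to_map scale r f - tensor_to_map scale (flip r) f"
  using assms
  by (intro tensor_to_map_eqI)
    (simp add: dual_space_diff apply_tensor_to_map flip_tensor_space)

end

section \<open>Pairing identities and the homomorphisms \<open>P\<close> and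
  \<open>Q\<close>\<close>

locale quasi_triangular_leibniz = finite_dimensional_vector_space scale Basis
  for scale :: "'k::field \<Rightarrow> 'a::ab_group_add \<Rightarrow> 'a" and Basis +
  fixes br :: "'a \<Rightarrow> 'a \<Rightarrow> 'a" and r :: "('a \<Rightarrow> 'k) \<Rightarrow> ('a \<Rightarrow> 'k) \<Rightarrow> 'k"
  assumes quasi_triangular: "quasi_triangular scale br r"
begin

abbreviation "D \<equiv> dual_space scale"
abbreviation "P \<equiv> tensor_to_map scale r"
abbreviation "Q \<equiv> tensor_to_map scale (flip r)"

lemma leibniz: "leibniz_algebra scale br"
  and tensor: "r \<in> tensor_space scale"
  and yang_baxter: "double_bracket scale br r = 0"
  and invariant: "leibniz_F scale br x (r - flip r) = 0"
  using quasi_triangular by (auto simp: quasi_triangular_def clybe_solution_def)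

lemmas apply_P = apply_tensor_to_map[OF tensor]
  and apply_Q = apply_tensor_to_map_flip[OF tensor]

lemma br_linear:
  "br x (y + z) = br x y + br x z" "br (y + z) x = br y x + br z x"
  "br x (scale c y) = scale c (br x y)" "br (scale c y) x = scale c (br y x)"
  using leibniz unfolding leibniz_algebra_on_def linear_map_on_def by blast+

lemma br_diff: "br x (y - z) = br x y - br x z" "br (y - z) x = br y x - br z x"
  using br_linear(1)[of x "y - z" z] br_linear(2)[of "y - z" z x] by simp_all

lemma dual_space_br:
  assumes "f \<in> D"
  shows "(\<lambda>x. f (br x y)) \<in> D" "(\<lambda>x. f (br y x)) \<in> D" "(\<lambda>x. f (br x y + br y x)) \<in> D"
    "(\<lambda>x. f (br y x + br x y)) \<in> D"
  using assms by (auto intro!: dual_spaceI simp: br_linear dual_space_add dual_space_scale algebra_simps)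

text \<open>Here the pairing is resolved at its first slot, through \<open>Q\<close>, whereas
  \<open>apply_P\<close> resolves it at the second. Below, the slot resolved is the one whose
  functional is composed with a bracket.\<close>

lemma r_apply: "f \<in> D \<Longrightarrow> g \<in> D \<Longrightarrow> r f g = f (Q g)"
  by (simp add: apply_Q apply_P)

lemma dual_bracket_apply:
  assumes "f \<in> D" "g \<in> D"
  shows "dual_bracket scale br r f g x = f (br x (Q g) + br (Q g) x) - g (br (P f) x)"
  using assms dual_space_br[of f x] dual_space_br[of g x] apply_P[of f "\<lambda>y. g (br y x)"]
    r_apply[of "\<lambda>y. f (br x y + br y x)" g]
  by (simp add: dual_bracket_def coproduct_def leibniz_F_def tensor_map_def comp_def)

lemma dual_bracket_in_dual_space:
  assumes "f \<in> D" "g \<in> D"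
  shows "dual_bracket scale br r f g \<in> D"
  by (rule dual_spaceI)
    (simp_all add: dual_bracket_apply assms br_linear dual_space_add[OF assms(1)]
      dual_space_add[OF assms(2)] dual_space_scale[OF assms(1)] dual_space_scale[OF assms(2)]
      algebra_simps)

text \<open>This is the pairing of the invariance condition with \<open>f\<close> and
  \<open>g\<close>, up to sign: replacing \<open>r\<close> by \<open>flip r\<close> exchanges
  \<open>P\<close> and \<open>Q\<close>.\<close>

lemma invariant_apply:
  assumes "f \<in> D" "g \<in> D"
  shows "f (br x (P g - Q g) + br (P g - Q g) x) + g (br (P f - Q f) x) = 0"
proof -
  have "leibniz_F scale br x (r - flip r) f g = 0"
    by (simp add: invariant)
  then have "r (\<lambda>y. f (br x y + br y x)) g - r g (\<lambda>y. f (br x y + br y x))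
      - (r f (\<lambda>y. g (br y x)) - r (\<lambda>y. g (br y x)) f) = 0"
    using assms by (simp add: leibniz_F_def tensor_map_def comp_def flip_def)
  then have "f (br x (Q g) + br (Q g) x) - f (br x (P g) + br (P g) x)
      - (g (br (P f) x) - g (br (Q f) x)) = 0"
    using assms dual_space_br[of f x] dual_space_br[of g x] apply_P[of f "\<lambda>y. g (br y x)"]
      apply_P[of g "\<lambda>y. f (br x y + br y x)"] r_apply[of "\<lambda>y. g (br y x)" f]
      r_apply[of "\<lambda>y. f (br x y + br y x)" g]
    by simp
  then show ?thesis
    using assms by (simp add: br_diff dual_space_add dual_space_diff algebra_simps)
qed

text \<open>By \<open>bracket_sum_apply\<close> the double sum is a combination of iterated
  contractions of \<open>r\<close>. Each is evaluated from the inside out, a first slot giving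
  \<open>Q\<close> and a second slot giving \<open>P\<close>.\<close>

lemma yang_baxter_apply:
  assumes fgh: "f \<in> D" "g \<in> D" "h \<in> D"
  shows "f (br (Q g) (Q h)) - g (br (P f) (Q h) + br (Q h) (P f)) + h (br (P g) (P f)) = 0"
proof -
  obtain n :: nat and a b where r: "r = (\<Sum>i<n. tensor scale (a i) (b i))"
    using tensor by (auto simp: tensor_space_def)
  have Qh: "r (\<lambda>x. f (br x y)) g = f (br (Q g) y)" for y
    using r_apply[OF dual_space_br(1)[OF fgh(1)] fgh(2)] .
  have 1: "r (\<lambda>y. r (\<lambda>x. f (br x y)) g) h = f (br (Q g) (Q h))"
    unfolding Qh using r_apply[OF dual_space_br(2)[OF fgh(1)] fgh(3)] .
  have "r (\<lambda>y. g (br x y + br y x)) h = g (br x (Q h) + br (Q h) x)" for x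
    using r_apply[OF dual_space_br(4)[OF fgh(2)] fgh(3)] .
  then have 2: "r f (\<lambda>x. r (\<lambda>y. g (br x y + br y x)) h) = g (br (P f) (Q h) + br (Q h) (P f))"
    using apply_P[OF fgh(1) dual_space_br(3)[OF fgh(2)]] by simp
  have "r g (\<lambda>y. h (br y x)) = h (br (P g) x)" for x
    using apply_P[OF fgh(2) dual_space_br(1)[OF fgh(3)]] by simp
  then have 3: "r f (\<lambda>x. r g (\<lambda>y. h (br y x))) = h (br (P g) (P f))"
    using apply_P[OF fgh(1) dual_space_br(2)[OF fgh(3)]] by simp
  have "double_bracket scale br r f g h = 0"
    by (simp add: yang_baxter)
  then show ?thesis
    unfolding double_bracket_eq[OF leibniz r] bracket_sum_apply[OF leibniz r fgh] 1 2 3 .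
qed

lemma Q_dual_bracket:
  assumes fg: "f \<in> D" "g \<in> D"
  shows "Q (dual_bracket scale br r f g) = br (Q f) (Q g)"
proof (rule dual_separates)
  fix h assume h: "h \<in> D"
  \<comment> \<open>By adjointness the left side is the dual bracket evaluated at
    \<open>P h\<close>. Its terms are those of the Yang-Baxter equation for the arguments
    \<open>h\<close>, \<open>f\<close>, \<open>g\<close>, apart from the term
    \<open>h (br (Q f) (Q g))\<close>.\<close>
  show "h (Q (dual_bracket scale br r f g)) = h (br (Q f) (Q g))"
    using yang_baxter_apply[OF h fg] fg h
    by (simp add: apply_Q dual_bracket_in_dual_space dual_bracket_apply dual_space_add algebra_simps)
qed

lemma P_dual_bracket:
  assumes fg: "f \<in> D" "g \<in> D"
  shows "P (dual_bracket scale br r f g) = br (P f) (P g)"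
proof (rule dual_separates)
  fix h assume h: "h \<in> D"
  \<comment> \<open>Invariance at \<open>Q h\<close> allows \<open>Q g\<close> to be replaced by
    \<open>P g\<close> and, simultaneously, \<open>P f\<close> by \<open>Q f\<close> in the value of
    the dual bracket at \<open>Q h\<close>.\<close>
  have "f (br (Q h) (P g)) + f (br (P g) (Q h)) - f (br (Q h) (Q g)) - f (br (Q g) (Q h))
      + g (br (P f) (Q h)) - g (br (Q f) (Q h)) = 0"
    using invariant_apply[OF fg, of "Q h"] fg
    by (simp add: br_diff dual_space_add dual_space_diff algebra_simps)
  \<comment> \<open>The arguments are ordered \<open>g\<close>, \<open>f\<close>, \<open>h\<close>,
    so that the last term is the desired \<open>h (br (P f) (P g))\<close>; the other terms are
    those obtained after the replacement.\<close>
  moreover have "g (br (Q f) (Q h)) - (f (br (P g) (Q h)) + f (br (Q h) (P g)))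
      + h (br (P f) (P g)) = 0"
    using yang_baxter_apply[OF fg(2) fg(1) h] fg by (simp add: dual_space_add)
  moreover have "h (P (dual_bracket scale br r f g))
      = f (br (Q h) (Q g)) + f (br (Q g) (Q h)) - g (br (P f) (Q h))"
    using fg h
    by (simp add: apply_Q[symmetric] dual_bracket_in_dual_space dual_bracket_apply dual_space_add)
  ultimately show "h (P (dual_bracket scale br r f g)) = h (br (P f) (P g))"
    by algebra
qed

end

theorem lemma3p3:
  fixes scale :: "'k::{alg_closed_field, field_char_0} \<Rightarrow> 'a::ab_group_add \<Rightarrow> 'a"
    and Basis :: "'a set"
    and br :: "'a \<Rightarrow> 'a \<Rightarrow> 'a"
    and r :: "('a \<Rightarrow> 'k) \<Rightarrow> ('a \<Rightarrow> 'k) \<Rightarrow> 'k"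
  assumes "finite_dimensional_vector_space scale Basis"
    and "factorizable scale br r"
  shows "leibniz_subalgebra (module_prod.scale scale scale) (prod_bracket br) (image_T_sum scale r) \<and>
    leibniz_isomorphic
      (image_T_sum scale r) (module_prod.scale scale scale) (prod_bracket br)
      (dual_space scale) dual_scale (dual_bracket scale br r) \<and>
    (\<forall>x. \<exists>!p. p \<in> image_T_sum scale r \<and> x = fst p - snd p)"
proof -
  interpret finite_dimensional_vector_space scale Basis by fact
  interpret quasi_triangular_leibniz scale Basis br r
    by unfold_locales (use assms(2) in \<open>simp add: factorizable_def\<close>)
  interpret p: vector_space_prod scale scale ..
  have "bij_betw (tensor_to_map scale (r - flip r)) D UNIV"
    using assms(2) by (simp add: factorizable_def)
  \<comment> \<open>On the dual, the map attached to \<open>r - flip r\<close> is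
    \<open>P - Q\<close>.\<close>
  then have bij: "bij_betw (\<lambda>f. P f - Q f) D UNIV"
    using tensor_to_map_minus_flip[OF tensor] by (simp cong: bij_betw_cong)
  let ?\<phi> = "\<lambda>f. (P f, Q f)"
  have lin: "linear_map_on D dual_scale (module_prod.scale scale scale) ?\<phi>"
    using linear_map_on_tensor_to_map[OF tensor]
      linear_map_on_tensor_to_map[OF flip_tensor_space[OF tensor]]
    by (simp add: linear_map_on_def p.scale_def)
  \<comment> \<open>If both components agree at two functionals, so do their differences
    \<open>P - Q\<close>.\<close>
  have inj: "inj_on ?\<phi> D"
    using bij by (auto simp: bij_betw_def inj_on_def)
  have hom: "?\<phi> (dual_bracket scale br r f g) = prod_bracket br (?\<phi> f) (?\<phi> g)"
    if "f \<in> D" "g \<in> D" for f g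
    using that by (simp add: P_dual_bracket Q_dual_bracket prod_bracket_def)
  have unique: "\<exists>!p. p \<in> ?\<phi> ` D \<and> x = fst p - snd p" for x
  proof -
    \<comment> \<open>Surjectivity of \<open>P - Q\<close> provides the decomposition; its
      injectivity forces any other pair in the image with the same difference to come from the same
      functional.\<close>
    have "x \<in> (\<lambda>f. P f - Q f) ` D"
      using bij by (simp add: bij_betw_def)
    then obtain f where f: "f \<in> D" "x = P f - Q f"
      by blast
    show ?thesis
    proof (rule ex1I[of _ "?\<phi> f"])
      show "?\<phi> f \<in> ?\<phi> ` D \<and> x = fst (?\<phi> f) - snd (?\<phi> f)"
        using f by simp
      fix p assume p: "p \<in> ?\<phi> ` D \<and> x = fst p - snd p"
      then obtain g where g: "g \<in> D" "p = ?\<phi> g"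
        by blast
      with p f have "P g - Q g = P f - Q f"
        by simp
      then have "g = f"
        using bij f(1) g(1) unfolding bij_betw_def inj_on_def by blast
      then show "p = ?\<phi> f"
        using g(2) by simp
    qed
  qed
  have closed: "dual_bracket scale br r f g \<in> D" if "f \<in> D" "g \<in> D" for f g
    using that by (rule dual_bracket_in_dual_space)
  note image = leibniz_isomorphic_image[where br = "dual_bracket scale br r",
      OF vector_space_dual_scale subspace_dual_space _ leibniz_algebra_prod[OF leibniz]
      lin inj]
  show ?thesis
    unfolding image_T_sum_def
  proof (intro conjI allI unique)
    show "leibniz_subalgebra (module_prod.scale scale scale) (prod_bracket br) (?\<phi> ` D)"
      by (rule image(1)) (use closed hom in blast)+
    show "leibniz_isomorphic (?\<phi> ` D) (module_prod.scale scale scale) (prod_bracket br)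
        D dual_scale (dual_bracket scale br r)"
      by (rule image(2)) (use closed hom in blast)+
  qed
qed

end
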